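(* Let $w_1,\dots,w_m$ be scalar discrete weights supported on the same discrete set $\mathcal J$ (either $\mathbb N_0$ or $\{0,1,\dots,N\}$), and let $p_n^{w_i}$ be the monic orthogonal polynomials for $w_i$, $1\le i\le m$. Suppose each $p_n^{w_i}$ is an eigenfunction of a second-order difference operator $\delta_i$ with eigenvalue $\Lambda_n(\delta_i)$, i.e. $p_n^{w_i}(x)\cdot\delta_i=\Lambda_n(\delta_i)\,p_n^{w_i}(x)$, such that the condition $$\Lambda_n(\delta_i)=\Lambda_{n+1}(\delta_j)\quad\text{for all odd } i \text{ and even } j$$ is satisfied. Let $a_1,\dots,a_{m-1}\in\mathbb R\setminus\{0\}$, $$A=\sum_{j=1}^{[m/2]} a_{2j-1}E_{2j-1,2j}+\sum_{j=1}^{[(m-1)/2]} a_{2j}E_{2j+1,2j},$$ let $P_n(x)=\operatorname{diag}(p_n^{w_1}(x),\dots,p_n^{w_m}(x))$ and $\|P_n\|^2=\operatorname{diag}(\|p_n^{w_1}\|^2,\dots,\|p_n^{w_m}\|^2)$, and let $$Q_n(x)=P_n(x)+AP_{n+1}(x)-\|P_n\|^2A^*\|P_{n-1}\|^{-2}P_{n-1}(x)-P_n(x)Ax+\|P_n\|^2A^*\|P_{n-1}\|^{-2}P_{n-1}(x)Ax$$ for $n\in\mathbb N_0$ if $\mathcal J=\mathbb N_0$, and for $n=0,1,\dots,N$ if $\mathcal J=\{0,1,\dots,N\}$. Then the matrix polynomials $Q_n$ are eigenfunctions of a second-order difference operator.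
   Context: $E_{i,j}$ is the $m\times m$ matrix with $1$ in position $(i,j)$ and $0$ elsewhere; $[\,\cdot\,]$ is the integer part; $^*$ is the conjugate transpose. A scalar weight supported on $\mathcal J$ is a function $w:\mathbb Z\to\mathbb R$ with $w(x)>0$ for $x\in\mathcal J$, $w(x)=0$ for $x\notin\mathcal J$, and finite moments $\sum_{x\in\mathcal J}x^nw(x)$ of all orders. $\|p\|^2=\sum_{x\in\mathcal J}|p(x)|^2w(x)$. The monic orthogonal polynomials $p_n^{w}$ ($n\in\mathbb N_0$, or $n=0,\dots,N$ if $\mathcal J=\{0,\dots,N\}$) are the monic polynomials with $\deg p_n^w=n$ and $\sum_{x\in\mathcal J}p_n^w(x)\overline{p_k^w(x)}w(x)=0$ for $n\ne k$. Conventions: if $\mathcal J=\{0,\dots,N\}$, each scalar sequence is extended by setting $p_{N+1}^{w_i}(x)=x(x-1)\cdots(x-N)$ (this is the polynomial entering $Q_N$). Also $P_{-1}(x)=0$, so that $Q_0(x)=P_0(x)+AP_1(x)-P_0(x)Ax$. Difference operators: with $\Delta(f(x))=f(x+1)-f(x)$ and $\nabla(f(x))=f(x)-f(x-1)$ (entrywise on matrix functions), a difference operator is an expression $D=\sum_{j=0}^{s_1}\Delta^jF_j(x)+K(x)+\sum_{l=0}^{s_2}\nabla^lG_l(x)$ whose coefficients $F_j,K,G_l$ are matrix-valued (in the scalar case, scalar) polynomials, acting on the right of functions by $P(x)\cdot D=\sum_j\Delta^j(P(x))F_j(x)+P(x)K(x)+\sum_l\nabla^l(P(x))G_l(x)$.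 A sequence $Q_n$ of $m\times m$ matrix polynomials is an eigenfunction of $D$ if $Q_n(x)\cdot D=\Lambda_n(D)Q_n(x)$ for all $n$, with $\Lambda_n(D)\in\operatorname{Mat}_m(\mathbb C)$. *)

theory Defs
  imports
    "HOL-Analysis.Infinite_Sum"
    "Jordan_Normal_Form.Schur_Decomposition"
begin

section \<open>Scalar weights and monic orthogonal polynomials\<close>

definition scalar_weight :: "int set \<Rightarrow> (int \<Rightarrow> real) \<Rightarrow> bool" where
  "scalar_weight J w \<longleftrightarrow>
     (\<forall>x\<in>J. w x > 0) \<and> (\<forall>x. x \<notin> J \<longrightarrow> w x = 0) \<and>
     (\<forall>n::nat. (\<lambda>x. of_int x ^ n * w x) summable_on J)"

definition weight_inner :: "int set \<Rightarrow> (int \<Rightarrow> real) \<Rightarrow> complex poly \<Rightarrow> complex poly \<Rightarrow> complex" where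
  "weight_inner J w p q =
     (\<Sum>\<^sub>\<infinity>x\<in>J. poly p (of_int x) * cnj (poly q (of_int x)) * of_real (w x))"

definition weight_norm_sq :: "int set \<Rightarrow> (int \<Rightarrow> real) \<Rightarrow> complex poly \<Rightarrow> real" where
  "weight_norm_sq J w p = (\<Sum>\<^sub>\<infinity>x\<in>J. (cmod (poly p (of_int x)))\<^sup>2 * w x)"

text \<open>The index range of the sequences: all of \<open>\<nat>\<close> if \<open>J = \<nat>\<close>, and \<open>{0..N}\<close> if
  \<open>J = {0..N}\<close>; it is the set \<open>J\<close> itself, read inside \<^typ>\<open>nat\<close>.\<close>

definition index_range :: "int set \<Rightarrow> nat set" where
  "index_range J = {n. int n \<in> J}"

text \<open>The last conjunct is the convention \<open>p\<^sub>N\<^sub>+\<^sub>1 = x(x-1)\<cdots>(x-N)\<close> for finite support. The values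
  \<open>p n\<close> with \<open>n > N + 1\<close> are unconstrained and never used.\<close>

definition monic_orthogonal :: "int set \<Rightarrow> (int \<Rightarrow> real) \<Rightarrow> (nat \<Rightarrow> complex poly) \<Rightarrow> bool" where
  "monic_orthogonal J w p \<longleftrightarrow>
     (\<forall>n\<in>index_range J. degree (p n) = n \<and> lead_coeff (p n) = 1) \<and>
     (\<forall>n\<in>index_range J. \<forall>k\<in>index_range J. n \<noteq> k \<longrightarrow> weight_inner J w (p n) (p k) = 0) \<and>
     (\<forall>N. J = {0..int N} \<longrightarrow> p (Suc N) = (\<Prod>k\<le>N. [:- of_nat k, 1:]))"


section \<open>Difference operators\<close>

definition fwd_diff :: "complex poly \<Rightarrow> complex poly" where
  "fwd_diff p = pcompose p [:1, 1:] - p"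

definition bwd_diff :: "complex poly \<Rightarrow> complex poly" where
  "bwd_diff p = p - pcompose p [:-1, 1:]"

text \<open>The data of \<open>D = \<Sum>\<^sub>j\<^sub>\<le>\<^sub>s\<^sub>1 \<Delta>\<^sup>j F\<^sub>j + K + \<Sum>\<^sub>l\<^sub>\<le>\<^sub>s\<^sub>2 \<nabla>\<^sup>l G\<^sub>l\<close>. The coefficients are of type
  \<^typ>\<open>complex poly\<close> for scalar operators and \<^typ>\<open>complex poly mat\<close> (matrices with polynomial
  entries) for matrix operators; \<open>fwd_coeff j\<close> is meaningful only for \<open>j \<le> fwd_order\<close>, and
  \<open>bwd_coeff l\<close> only for \<open>l \<le> bwd_order\<close>.\<close>

record 'c diff_op =
  fwd_order :: nat
  bwd_order :: nat
  fwd_coeff :: "nat \<Rightarrow> 'c"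
  mid_coeff :: 'c
  bwd_coeff :: "nat \<Rightarrow> 'c"

definition scalar_act :: "complex poly \<Rightarrow> complex poly diff_op \<Rightarrow> complex poly" where
  "scalar_act p D =
     (\<Sum>j\<le>fwd_order D. (fwd_diff ^^ j) p * fwd_coeff D j) + p * mid_coeff D
     + (\<Sum>l\<le>bwd_order D. (bwd_diff ^^ l) p * bwd_coeff D l)"

text \<open>Sums of matrices are formed entry by entry, because \<^typ>\<open>'a mat\<close> has no zero of its own.\<close>

definition matrix_act ::
    "nat \<Rightarrow> complex poly mat \<Rightarrow> complex poly mat diff_op \<Rightarrow> complex poly mat" where
  "matrix_act m P D =
     Matrix.mat m m (\<lambda>rs.
       (\<Sum>j\<le>fwd_order D. (map_mat (fwd_diff ^^ j) P * fwd_coeff D j) $$ rs)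
       + (P * mid_coeff D) $$ rs
       + (\<Sum>l\<le>bwd_order D. (map_mat (bwd_diff ^^ l) P * bwd_coeff D l) $$ rs))"

definition is_matrix_diff_op :: "nat \<Rightarrow> complex poly mat diff_op \<Rightarrow> bool" where
  "is_matrix_diff_op m D \<longleftrightarrow>
     (\<forall>j\<le>fwd_order D. fwd_coeff D j \<in> carrier_mat m m) \<and>
     mid_coeff D \<in> carrier_mat m m \<and>
     (\<forall>l\<le>bwd_order D. bwd_coeff D l \<in> carrier_mat m m)"

text \<open>Second order means that the operator involves exactly the values at \<open>x+1\<close>, \<open>x\<close> and \<open>x-1\<close>
  (as \<open>\<Delta>\<nabla> = \<Delta> - \<nabla>\<close> does): \<open>s\<^sub>1 = s\<^sub>2 = 1\<close>, with nonzero coefficients of \<open>\<Delta>\<close> and of \<open>\<nabla>\<close>. Without the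
  nonvanishing, constant operators would count as second-order.\<close>

definition second_order_scalar :: "complex poly diff_op \<Rightarrow> bool" where
  "second_order_scalar D \<longleftrightarrow>
     fwd_order D = 1 \<and> bwd_order D = 1 \<and> fwd_coeff D 1 \<noteq> 0 \<and> bwd_coeff D 1 \<noteq> 0"

definition second_order_matrix :: "nat \<Rightarrow> complex poly mat diff_op \<Rightarrow> bool" where
  "second_order_matrix m D \<longleftrightarrow>
     is_matrix_diff_op m D \<and> fwd_order D = 1 \<and> bwd_order D = 1 \<and>
     fwd_coeff D 1 \<noteq> 0\<^sub>m m m \<and> bwd_coeff D 1 \<noteq> 0\<^sub>m m m"

definition const_poly_mat :: "complex mat \<Rightarrow> complex poly mat" where
  "const_poly_mat M = map_mat (\<lambda>c. [:c:]) M"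

definition eigenfunction_matrix ::
    "nat \<Rightarrow> nat set \<Rightarrow> (nat \<Rightarrow> complex poly mat) \<Rightarrow> complex poly mat diff_op \<Rightarrow> bool" where
  "eigenfunction_matrix m I Q D \<longleftrightarrow>
     (\<exists>\<Lambda>. \<forall>n\<in>I. \<Lambda> n \<in> carrier_mat m m \<and>
        matrix_act m (Q n) D = const_poly_mat (\<Lambda> n) * Q n)"


section \<open>The matrix polynomials \<open>Q\<^sub>n\<close>\<close>

text \<open>Families indexed by \<open>1, \<dots>, m\<close> keep this 1-based indexing; only the positions inside a
  \<^typ>\<open>'a mat\<close> are 0-based. Thus \<open>unit_mat m i j\<close> is \<open>E\<^sub>i\<^sub>,\<^sub>j\<close> with 1-based \<open>i\<close>, \<open>j\<close>, and \<open>diag1 m f\<close>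
  is \<open>diag(f 1, \<dots>, f m)\<close>.\<close>

definition unit_mat :: "nat \<Rightarrow> nat \<Rightarrow> nat \<Rightarrow> complex mat" where
  "unit_mat m i j = Matrix.mat m m (\<lambda>(r, s). if Suc r = i \<and> Suc s = j then 1 else 0)"

definition diag1 :: "nat \<Rightarrow> (nat \<Rightarrow> 'a::zero) \<Rightarrow> 'a mat" where
  "diag1 m f = mat_diag m (\<lambda>k. f (Suc k))"

definition A_mat :: "nat \<Rightarrow> (nat \<Rightarrow> real) \<Rightarrow> complex mat" where
  "A_mat m a =
     Matrix.mat m m (\<lambda>rs.
       (\<Sum>j=1..m div 2. of_real (a (2*j - 1)) * unit_mat m (2*j - 1) (2*j) $$ rs)
       + (\<Sum>j=1..(m - 1) div 2. of_real (a (2*j)) * unit_mat m (2*j + 1) (2*j) $$ rs))"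

definition P_diag :: "nat \<Rightarrow> (nat \<Rightarrow> nat \<Rightarrow> complex poly) \<Rightarrow> nat \<Rightarrow> complex poly mat" where
  "P_diag m p n = diag1 m (\<lambda>i. p i n)"

definition P_norm_sq ::
    "nat \<Rightarrow> int set \<Rightarrow> (nat \<Rightarrow> int \<Rightarrow> real) \<Rightarrow> (nat \<Rightarrow> nat \<Rightarrow> complex poly) \<Rightarrow> nat \<Rightarrow> complex mat" where
  "P_norm_sq m J w p n = diag1 m (\<lambda>i. of_real (weight_norm_sq J (w i) (p i n)))"

definition P_norm_sq_inv ::
    "nat \<Rightarrow> int set \<Rightarrow> (nat \<Rightarrow> int \<Rightarrow> real) \<Rightarrow> (nat \<Rightarrow> nat \<Rightarrow> complex poly) \<Rightarrow> nat \<Rightarrow> complex mat" where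
  "P_norm_sq_inv m J w p n = diag1 m (\<lambda>i. inverse (of_real (weight_norm_sq J (w i) (p i n))))"

text \<open>For \<open>n = 0\<close> the index \<open>n - 1\<close> truncates to \<open>0\<close>; this is harmless, as \<open>P\<^sub>-\<^sub>1 = 0\<close> is set
  separately and makes both terms with \<open>\<parallel>P\<^sub>n\<^sub>-\<^sub>1\<parallel>\<^sup>-\<^sup>2\<close> vanish.\<close>

definition Q_mat ::
    "nat \<Rightarrow> int set \<Rightarrow> (nat \<Rightarrow> int \<Rightarrow> real) \<Rightarrow> (nat \<Rightarrow> nat \<Rightarrow> complex poly) \<Rightarrow> (nat \<Rightarrow> real)
      \<Rightarrow> nat \<Rightarrow> complex poly mat" where
  "Q_mat m J w p a n =
     (let A = const_poly_mat (A_mat m a);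
          Ax = [:0, 1:] \<cdot>\<^sub>m A;
          P = P_diag m p n;
          Pnext = P_diag m p (Suc n);
          Pprev = (if n = 0 then 0\<^sub>m m m else P_diag m p (n - 1));
          B = const_poly_mat
                (P_norm_sq m J w p n * mat_adjoint (A_mat m a) * P_norm_sq_inv m J w p (n - 1))
      in P + A * Pnext - B * Pprev - P * Ax + B * Pprev * Ax)"

end

theory Submission
  imports Defs
begin

text \<open>
  Since \<open>A\<close> has nonzero entries only in (odd, even) positions, \<open>AMA = 0\<close> for every diagonal \<open>M\<close>.
  Hence \<open>Q\<^sub>n = R\<^sub>n (I - Ax)\<close> with \<open>R\<^sub>n = P\<^sub>n + A P\<^sub>n\<^sub>+\<^sub>1 - \<parallel>P\<^sub>n\<parallel>\<^sup>2 A\<^sup>* \<parallel>P\<^sub>n\<^sub>-\<^sub>1\<parallel>\<^sup>-\<^sup>2 P\<^sub>n\<^sub>-\<^sub>1\<close>, and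
  \<open>I - Ax\<close> has the inverse \<open>T = I + Ax\<close>. The compatibility of the eigenvalues says that \<open>R\<^sub>n\<close> is an
  eigenfunction of \<open>\<delta> = diag(\<delta>\<^sub>1, \<dots>, \<delta>\<^sub>m)\<close> with eigenvalue \<open>diag(\<Lambda>\<^sub>n(\<delta>\<^sub>1), \<dots>, \<Lambda>\<^sub>n(\<delta>\<^sub>m))\<close>, so \<open>Q\<^sub>n\<close> is
  an eigenfunction of \<open>T \<delta> T\<^sup>-\<^sup>1\<close> with the same eigenvalue. Conjugation keeps the order, because
  \<open>T\<close> and \<open>T\<^sup>-\<^sup>1\<close> are polynomial.
\<close>

section \<open>Second-order operators in shift form\<close>

lemma scalar_act_order_one:
  assumes "fwd_order D = 1" "bwd_order D = 1"
  shows "scalar_act f D =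
    pcompose f [:1, 1:] * fwd_coeff D 1
    + f * (mid_coeff D + fwd_coeff D 0 + bwd_coeff D 0 - fwd_coeff D 1 + bwd_coeff D 1)
    - pcompose f [:-1, 1:] * bwd_coeff D 1"
  using assms by (simp add: scalar_act_def fwd_diff_def bwd_diff_def algebra_simps)

lemma scalar_act_const_mult:
  assumes "fwd_order D = 1" "bwd_order D = 1"
  shows "scalar_act ([:c:] * f) D = [:c:] * scalar_act f D"
  using assms by (simp add: scalar_act_order_one pcompose_smult smult_add_right smult_diff_right)

text \<open>Written through the shifts \<open>x \<mapsto> x \<plusminus> 1\<close> instead of \<open>\<Delta>\<close> and \<open>\<nabla>\<close>, operators are easy to conjugate,
  because shifts, unlike differences, are multiplicative.\<close>

definition shift_act ::
    "complex poly mat \<Rightarrow> complex poly mat \<Rightarrow> complex poly mat \<Rightarrow> complex poly mat \<Rightarrow> complex poly mat"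
  where
  "shift_act U V W P =
     map_mat (\<lambda>f. pcompose f [:1, 1:]) P * U + P * V + map_mat (\<lambda>f. pcompose f [:-1, 1:]) P * W"

text \<open>Expanding the differences, \<open>\<Delta>\<close> with coefficient \<open>U\<close>
  leaves \<open>- U\<close> at the unshifted value, and \<open>\<nabla>\<close> with coefficient
  \<open>- W\<close> leaves \<open>- W\<close>. The summands \<open>U\<close> and \<open>W\<close>
  of \<open>mid_coeff\<close> cancel these.\<close>

definition shift_diff_op ::
    "complex poly mat \<Rightarrow> complex poly mat \<Rightarrow> complex poly mat \<Rightarrow> complex poly mat diff_op"
  where
  "shift_diff_op U V W =
     \<lparr>fwd_order = 1, bwd_order = 1,
      fwd_coeff = (\<lambda>j. if j = 1 then U else 0\<^sub>m (dim_row U) (dim_col U)),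
      mid_coeff = U + V + W,
      bwd_coeff = (\<lambda>j. if j = 1 then - W else 0\<^sub>m (dim_row W) (dim_col W))\<rparr>"

lemma matrix_act_shift_diff_op:
  assumes "U \<in> carrier_mat m m" "V \<in> carrier_mat m m" "W \<in> carrier_mat m m" "P \<in> carrier_mat m m"
  shows "matrix_act m P (shift_diff_op U V W) = shift_act U V W P"
  using assms
  by (intro eq_matI)
    (auto simp: matrix_act_def shift_act_def shift_diff_op_def fwd_diff_def bwd_diff_def
      scalar_prod_def algebra_simps sum.distrib sum_subtractf sum_negf)

lemma second_order_matrix_shift_diff_op:
  assumes "U \<in> carrier_mat m m" "V \<in> carrier_mat m m" "W \<in> carrier_mat m m"
    and "r < m" "s < m" "U $$ (r, s) \<noteq> 0" "W $$ (r, s) \<noteq> 0"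
  shows "second_order_matrix m (shift_diff_op U V W)"
proof -
  have "- W \<noteq> 0\<^sub>m m m"
  proof
    assume "- W = 0\<^sub>m m m"
    then have "(- W) $$ (r, s) = 0" using assms(4,5) by simp
    then show False using assms by simp
  qed
  moreover have "U \<noteq> 0\<^sub>m m m" using assms by auto
  ultimately show ?thesis
    using assms(1-3)
    by (auto simp: second_order_matrix_def is_matrix_diff_op_def shift_diff_op_def)
qed

section \<open>Conjugation by an invertible polynomial matrix\<close>

lemma map_mat_pcompose_mult:
  fixes P S :: "complex poly mat"
  assumes "P \<in> carrier_mat m m" "S \<in> carrier_mat m m"
  shows "map_mat (\<lambda>f. pcompose f g) (P * S) =
    map_mat (\<lambda>f. pcompose f g) P * map_mat (\<lambda>f. pcompose f g) S"
  using assms by (intro eq_matI) (auto simp: scalar_prod_def pcompose_sum pcompose_mult)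

lemma map_mat_pcompose_one:
  "map_mat (\<lambda>f. pcompose f g) (1\<^sub>m m) = (1\<^sub>m m :: complex poly mat)"
  by (intro eq_matI) auto

lemma mult_inverse_cancel_mat:
  fixes R S T U :: "'a::comm_ring_1 mat"
  assumes "R \<in> carrier_mat m m" "S \<in> carrier_mat m m" "T \<in> carrier_mat m m" "U \<in> carrier_mat m m"
    and "S * T = 1\<^sub>m m"
  shows "(R * S) * (T * U * S) = R * U * S"
proof -
  have "(R * S) * (T * U * S) = R * (S * T) * U * S"
    using assms(1-4) by (simp add: assoc_mult_mat[of _ m m _ m _ m])
  then show ?thesis using assms by simp
qed

text \<open>Shifting \<open>R * S\<close> also shifts \<open>S\<close>, so only an equally shifted
  \<open>T\<close> can cancel it. The \<open>S\<close> on the far right is applied after the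
  operator and stays unshifted.\<close>

lemma shift_act_conjugate:
  assumes carr: "R \<in> carrier_mat m m" "S \<in> carrier_mat m m" "T \<in> carrier_mat m m"
      "U \<in> carrier_mat m m" "V \<in> carrier_mat m m" "W \<in> carrier_mat m m"
    and inv: "S * T = 1\<^sub>m m"
  shows "shift_act (map_mat (\<lambda>f. pcompose f [:1, 1:]) T * U * S) (T * V * S)
      (map_mat (\<lambda>f. pcompose f [:-1, 1:]) T * W * S) (R * S) = shift_act U V W R * S"
proof -
  have sh: "map_mat (\<lambda>f. pcompose f g) (R * S) * (map_mat (\<lambda>f. pcompose f g) T * X * S) =
      map_mat (\<lambda>f. pcompose f g) R * X * S" if X: "X \<in> carrier_mat m m" for g X
  proof -
    let ?h = "map_mat (\<lambda>f. pcompose f g)"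
    have i: "?h S * ?h T = 1\<^sub>m m"
      using map_mat_pcompose_mult[OF carr(2,3), of g] by (simp add: inv map_mat_pcompose_one)
    have "?h (R * S) * (?h T * X * S) = ?h R * (?h S * ?h T) * X * S"
      using carr X by (simp add: map_mat_pcompose_mult[OF carr(1,2)] assoc_mult_mat[of _ m m _ m _ m])
    then show ?thesis using i carr by simp
  qed
  have carr': "map_mat (\<lambda>f. pcompose f g) R * X \<in> carrier_mat m m" "R * X \<in> carrier_mat m m"
    if "X \<in> carrier_mat m m" for g X
    using carr(1) that by (auto intro!: mult_carrier_mat[of _ m m])
  show ?thesis
    unfolding shift_act_def sh[OF carr(4)] sh[OF carr(6)]
      mult_inverse_cancel_mat[OF carr(1,2,3,5) inv]
    using carr carr' by (simp add: add_mult_distrib_mat[of _ m m _ _ m] del: assoc_mult_mat)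
qed

section \<open>Parity pattern of \<open>A_mat\<close> and auxiliary matrix facts\<close>

lemma A_mat_carrier [simp]: "A_mat m a \<in> carrier_mat m m"
  by (simp add: A_mat_def)

text \<open>Positions of a matrix are 0-based, so the (odd, even) positions of \<open>A\<close> have even \<open>r\<close>, odd \<open>s\<close>.\<close>

lemma A_mat_eq_0:
  assumes "r < m" "s < m" "odd r \<or> even s"
  shows "A_mat m a $$ (r, s) = 0"
proof -
  have "unit_mat m (2*j - 1) (2*j) $$ (r, s) = 0" if "j \<ge> 1" for j
    using assms that by (auto simp: unit_mat_def) presburger+
  moreover have "unit_mat m (2*j + 1) (2*j) $$ (r, s) = 0" if "j \<ge> 1" for j
    using assms that by (auto simp: unit_mat_def) presburger+
  ultimately show ?thesis using assms by (simp add: A_mat_def)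
qed

lemma A_mat_adjoint_eq_0:
  assumes "r < m" "s < m" "even r \<or> odd s"
  shows "mat_adjoint (A_mat m a) $$ (r, s) = 0"
  using assms A_mat_eq_0[of s m r a] A_mat_carrier[of m a]
  by (auto simp: mat_adjoint_def mat_of_rows_def conjugate_vec_def simp del: A_mat_carrier)

lemma mat_adjoint_carrier [simp]:
  "M \<in> carrier_mat m m \<Longrightarrow> mat_adjoint M \<in> carrier_mat m m"
  by (auto simp: mat_adjoint_def)

lemma const_poly_mat_carrier [simp]:
  "M \<in> carrier_mat m m \<Longrightarrow> const_poly_mat M \<in> carrier_mat m m"
  by (simp add: const_poly_mat_def)

lemma const_poly_mat_diag:
  "const_poly_mat (mat_diag m f) = mat_diag m (\<lambda>k. [:f k:])"
  by (auto simp: const_poly_mat_def mat_diag_def)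

lemma square_mult_carrier [simp, intro]:
  "M \<in> carrier_mat m m \<Longrightarrow> N \<in> carrier_mat m m \<Longrightarrow> M * N \<in> carrier_mat m m"
  by (rule mult_carrier_mat)

lemma diff_diff_eq_mat:
  fixes F G H :: "'a::ab_group_add mat"
  assumes "F \<in> carrier_mat m m" "G \<in> carrier_mat m m" "H \<in> carrier_mat m m"
  shows "F - (G - H) = F - G + H"
  using assms by (intro eq_matI) auto

lemma index_add_diff_mat:
  fixes F G H :: "'a::ab_group_add mat"
  assumes "F \<in> carrier_mat m m" "G \<in> carrier_mat m m" "H \<in> carrier_mat m m"
    and "r < m" "s < m"
  shows "(F + G - H) $$ (r, s) = F $$ (r, s) + G $$ (r, s) - H $$ (r, s)"
  using assms by auto

lemma P_diag_index:
  "r < m \<Longrightarrow> s < m \<Longrightarrow> P_diag m p n $$ (r, s) = (if r = s then p (Suc s) n else 0)"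
  by (simp add: P_diag_def diag1_def mat_diag_def)

text \<open>Each summand of an entry of the product has an inner index that is even, killing
  \<open>X\<close>, or odd, killing \<open>Y\<close>.\<close>

lemma parity_mult_eq_0:
  fixes X Y :: "'a::comm_ring_1 mat"
  assumes "X \<in> carrier_mat m m" "Y \<in> carrier_mat m m"
    and "\<And>r k. r < m \<Longrightarrow> k < m \<Longrightarrow> even k \<Longrightarrow> X $$ (r, k) = 0"
    and "\<And>k s. k < m \<Longrightarrow> s < m \<Longrightarrow> odd k \<Longrightarrow> Y $$ (k, s) = 0"
  shows "X * Y = 0\<^sub>m m m"
proof (rule eq_matI)
  fix r s assume *: "r < dim_row (0\<^sub>m m m)" "s < dim_col (0\<^sub>m m m)"
  have "X $$ (r, k) * Y $$ (k, s) = 0" if "k < m" for k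
    using assms(3)[of r k] assms(4)[of k s] * that by (cases "even k") auto
  then show "(X * Y) $$ (r, s) = 0\<^sub>m m m $$ (r, s)"
    using assms(1,2) * by (simp add: scalar_prod_def)
qed (use assms in auto)

text \<open>Column 0 of \<open>S\<close> is a unit vector, so the rest of row 0 of \<open>T\<close>
  is irrelevant. This shows that conjugation does not destroy the outer coefficients.\<close>

lemma diag_conjugate_index_0:
  fixes T S :: "'a::comm_ring_1 mat"
  assumes "T \<in> carrier_mat m m" "S \<in> carrier_mat m m" "m > 0" "T $$ (0, 0) = 1"
    and "\<And>k. k < m \<Longrightarrow> S $$ (k, 0) = (if k = 0 then 1 else 0)"
  shows "(T * mat_diag m u * S) $$ (0, 0) = u 0"
proof -
  have "(T * mat_diag m u * S) $$ (0, 0) = (\<Sum>k = 0..<m. T $$ (0, k) * u k * S $$ (k, 0))"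
    using assms(1-3) by (simp add: mat_diag_mult_right[of _ m] scalar_prod_def)
  also have "\<dots> = (\<Sum>k = 0..<m. if k = 0 then u 0 else 0)"
    using assms(4,5) by (intro sum.cong) auto
  finally show ?thesis using assms(3) by simp
qed

text \<open>Diagonal coefficients on the right scale columns, so column \<open>s\<close> sees only
  the scalar operator \<open>D s\<close>.\<close>

lemma shift_act_diag_index:
  assumes "R \<in> carrier_mat m m" "r < m" "s < m"
    and "fwd_order (D s) = 1" "bwd_order (D s) = 1"
  shows "shift_act (mat_diag m (\<lambda>k. fwd_coeff (D k) 1))
     (mat_diag m (\<lambda>k. mid_coeff (D k) + fwd_coeff (D k) 0 + bwd_coeff (D k) 0
        - fwd_coeff (D k) 1 + bwd_coeff (D k) 1))
     (mat_diag m (\<lambda>k. - bwd_coeff (D k) 1)) R $$ (r, s) = scalar_act (R $$ (r, s)) (D s)"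
  using assms by (simp add: shift_act_def mat_diag_mult_right[of _ m] scalar_act_order_one)

theorem theorem3p2:
  fixes m :: nat
    and J :: "int set"
    and w :: "nat \<Rightarrow> int \<Rightarrow> real"
    and p :: "nat \<Rightarrow> nat \<Rightarrow> complex poly"
    and \<delta> :: "nat \<Rightarrow> complex poly diff_op"
    and \<Lambda> :: "nat \<Rightarrow> nat \<Rightarrow> complex"
    and a :: "nat \<Rightarrow> real"
  assumes "m \<ge> 1"
    and "J = {0..} \<or> (\<exists>N::nat. J = {0..int N})"
    and "\<And>i. i \<in> {1..m} \<Longrightarrow> scalar_weight J (w i)"
    and "\<And>i. i \<in> {1..m} \<Longrightarrow> monic_orthogonal J (w i) (p i)"
    and "\<And>i. i \<in> {1..m} \<Longrightarrow> second_order_scalar (\<delta> i)"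
    and "\<And>i n. i \<in> {1..m} \<Longrightarrow> n \<in> index_range J \<Longrightarrow>
           scalar_act (p i n) (\<delta> i) = smult (\<Lambda> i n) (p i n)"
    \<comment> \<open>only new for \<open>J = {0..N}\<close> and \<open>n = N\<close>: it defines the eigenvalue \<open>\<Lambda> j (N + 1)\<close> used next\<close>
    and "\<And>j n. j \<in> {1..m} \<Longrightarrow> even j \<Longrightarrow> n \<in> index_range J \<Longrightarrow>
           scalar_act (p j (Suc n)) (\<delta> j) = smult (\<Lambda> j (Suc n)) (p j (Suc n))"
    and "\<And>i j n. i \<in> {1..m} \<Longrightarrow> j \<in> {1..m} \<Longrightarrow> odd i \<Longrightarrow> even j \<Longrightarrow> n \<in> index_range J \<Longrightarrow>
           \<Lambda> i n = \<Lambda> j (Suc n)"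
    and "\<And>k. k \<in> {1..m - 1} \<Longrightarrow> a k \<noteq> 0"
  shows "\<exists>D. second_order_matrix m D \<and>
             eigenfunction_matrix m (index_range J) (Q_mat m J w p a) D"
proof -
  define X where "X = [:0, 1:] \<cdot>\<^sub>m const_poly_mat (A_mat m a)"
  define S where "S = 1\<^sub>m m - X"
  define T where "T = 1\<^sub>m m + X"
  define B where "B n = const_poly_mat
      (P_norm_sq m J w p n * mat_adjoint (A_mat m a) * P_norm_sq_inv m J w p (n - 1))" for n
  define Pprev where "Pprev n = (if n = 0 then 0\<^sub>m m m else P_diag m p (n - 1))" for n
  define A where "A = const_poly_mat (A_mat m a)"
  define R where "R n = P_diag m p n + A * P_diag m p (Suc n) - B n * Pprev n" for n
  define U where "U = mat_diag m (\<lambda>k. fwd_coeff (\<delta> (Suc k)) 1)"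
  define V where "V = mat_diag m (\<lambda>k. mid_coeff (\<delta> (Suc k)) + fwd_coeff (\<delta> (Suc k)) 0
      + bwd_coeff (\<delta> (Suc k)) 0 - fwd_coeff (\<delta> (Suc k)) 1 + bwd_coeff (\<delta> (Suc k)) 1)"
  define W where "W = mat_diag m (\<lambda>k. - bwd_coeff (\<delta> (Suc k)) 1)"
  define L where "L n = mat_diag m (\<lambda>k. \<Lambda> (Suc k) n)" for n
  define T1 where "T1 = map_mat (\<lambda>f. pcompose f [:1, 1:]) T"
  define T2 where "T2 = map_mat (\<lambda>f. pcompose f [:-1, 1:]) T"
  define D where "D = shift_diff_op (T1 * U * S) (T * V * S) (T2 * W * S)"

  \<comment> \<open>Dimensions and zero patterns\<close>
  have carr_P: "P_diag m p n \<in> carrier_mat m m" "Pprev n \<in> carrier_mat m m" for n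
    by (simp_all add: P_diag_def diag1_def Pprev_def)
  have carr_AB: "A \<in> carrier_mat m m" "X \<in> carrier_mat m m" "B n \<in> carrier_mat m m" for n
    by (auto simp: A_def X_def B_def P_norm_sq_def P_norm_sq_inv_def diag1_def
        intro!: const_poly_mat_carrier mult_carrier_mat[of _ m m])
  have carr: "R n \<in> carrier_mat m m" "S \<in> carrier_mat m m" "T \<in> carrier_mat m m"
      "T1 \<in> carrier_mat m m" "T2 \<in> carrier_mat m m" "L n \<in> carrier_mat m m"
      "U \<in> carrier_mat m m" "V \<in> carrier_mat m m" "W \<in> carrier_mat m m" for n
    using carr_P carr_AB
    by (auto simp: R_def S_def T_def T1_def T2_def L_def U_def V_def W_def
        intro!: minus_carrier_mat add_carrier_mat mult_carrier_mat[of _ m m])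

  have A_zero: "A $$ (r, s) = 0" if "r < m" "s < m" "odd r \<or> even s" for r s
    using that carrier_matD[OF A_mat_carrier[of m a]]
    by (simp add: A_def const_poly_mat_def A_mat_eq_0)
  have X_zero: "X $$ (r, s) = 0" if "r < m" "s < m" "odd r \<or> even s" for r s
    using that carrier_matD[OF carr_AB(1)] A_zero[OF that] by (simp add: X_def A_def)
  have AP_index: "(A * P_diag m p n) $$ (r, s) = A $$ (r, s) * p (Suc s) n"
    if "r < m" "s < m" for r s n
    using that carr_AB(1) by (simp add: P_diag_def diag1_def mat_diag_mult_right[of _ m])
  have BP_index: "(B n * Pprev n) $$ (r, s)
      = (if n = 0 then 0 else B n $$ (r, s) * p (Suc s) (n - 1))"
    if "r < m" "s < m" for r s n
    using that carr_AB(3)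
    by (simp add: right_mult_zero_mat[OF carr_AB(3)] Pprev_def P_diag_def diag1_def mat_diag_mult_right[of _ m])
  have B_zero: "B n $$ (r, s) = 0" if "r < m" "s < m" "even r \<or> odd s" for r s n
    using that carrier_matD[OF mat_adjoint_carrier[OF A_mat_carrier[of m a]]]
    by (simp add: B_def const_poly_mat_def P_norm_sq_def P_norm_sq_inv_def diag1_def
        mat_diag_mult_right[of _ m] mat_diag_mult_left[of _ m m] A_mat_adjoint_eq_0)

  \<comment> \<open>Factorisation of \<open>Q_mat\<close> through \<open>S\<close>\<close>
  have XX: "X * X = 0\<^sub>m m m"
    using carr_AB by (intro parity_mult_eq_0) (auto simp: X_zero)
  have ST: "S * T = 1\<^sub>m m"
    using carr_AB(2) XX
    by (simp add: S_def T_def minus_mult_distrib_mat[of _ m m _ _ m]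
        mult_add_distrib_mat[of _ m m _ m]) auto
  \<comment> \<open>The diagonal factor only scales the columns of \<open>A\<close>, so its zero
    pattern survives.\<close>
  have APX: "A * P_diag m p n * X = 0\<^sub>m m m" for n
    using carr_AB carr_P by (intro parity_mult_eq_0) (auto simp: X_zero A_zero AP_index)
  have Q: "Q_mat m J w p a n = R n * S" for n
  proof -
    have APc: "A * P_diag m p (Suc n) \<in> carrier_mat m m" "B n * Pprev n \<in> carrier_mat m m"
      "P_diag m p n * X \<in> carrier_mat m m" "B n * Pprev n * X \<in> carrier_mat m m"
      using carr_AB carr_P by auto
    have "R n * X = P_diag m p n * X - B n * Pprev n * X"
      unfolding R_def using carr_AB carr_P[of n] APc APX[of "Suc n"]
      by (simp add: minus_mult_distrib_mat[of _ m m _ _ m] add_mult_distrib_mat[of _ m m _ _ m])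
    then have "R n * S = R n - (P_diag m p n * X - B n * Pprev n * X)"
      unfolding S_def using carr carr_AB by (simp add: mult_minus_distrib_mat[of _ m m _ m] right_mult_one_mat[OF carr(1)])
    also have "\<dots> = R n - P_diag m p n * X + B n * Pprev n * X"
      by (rule diff_diff_eq_mat[OF carr(1) APc(3,4)])
    finally show ?thesis
      by (simp add: Q_mat_def Let_def R_def A_def X_def B_def Pprev_def)
  qed

  \<comment> \<open>Eigenvalue equation for \<open>R\<close>\<close>
  have order: "fwd_order (\<delta> (Suc s)) = 1" "bwd_order (\<delta> (Suc s)) = 1"
      "fwd_coeff (\<delta> (Suc s)) 1 \<noteq> 0" "bwd_coeff (\<delta> (Suc s)) 1 \<noteq> 0" if "s < m" for s
    using assms(5)[of "Suc s"] that by (auto simp: second_order_scalar_def)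
  have prev: "n - 1 \<in> index_range J" if "n \<in> index_range J" for n
    using that assms(2) by (auto simp: index_range_def)

  \<comment> \<open>The operator acts from the right and belongs to column \<open>s\<close>; the
    eigenvalue multiplies from the left and belongs to row \<open>r\<close>. At most one of the
    three terms of \<open>R n\<close> survives at each position, and off the diagonal the
    compatibility condition must match column and row.\<close>
  have entry: "scalar_act (R n $$ (r, s)) (\<delta> (Suc s)) = [:\<Lambda> (Suc r) n:] * R n $$ (r, s)"
    if n: "n \<in> index_range J" and rs: "r < m" "s < m" for n r s
  proof -
    have Rrs: "R n $$ (r, s) = (if r = s then p (Suc s) n else 0) + A $$ (r, s) * p (Suc s) (Suc n)
        - (if n = 0 then 0 else B n $$ (r, s) * p (Suc s) (n - 1))"
      using rs unfolding R_def
      by (subst index_add_diff_mat[of _ m])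
        (auto simp: AP_index BP_index carr_AB carr_P P_diag_index simp del: index_mult_mat)
    obtain c where A_c: "A $$ (r, s) = [:c:]"
      using rs carrier_matD[OF A_mat_carrier[of m a]] by (simp add: A_def const_poly_mat_def)
    obtain b where B_b: "B n $$ (r, s) = [:b:]"
      using rs carrier_matD[OF carr_AB(3)[of n]] by (simp add: B_def const_poly_mat_def)
    have zero: "scalar_act 0 (\<delta> (Suc s)) = 0"
      using order[OF rs(2)] by (simp add: scalar_act_order_one)
    consider (diag) "even r = even s" | (up) "even r" "odd s" | (down) "odd r" "even s" by blast
    then show ?thesis
    proof cases
      case diag
      then have "A $$ (r, s) = 0" "B n $$ (r, s) = 0"
        using rs by (auto simp: A_zero B_zero)
      then have "R n $$ (r, s) = (if r = s then p (Suc s) n else 0)" by (simp add: Rrs)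
      then show ?thesis using assms(6)[of "Suc s" n] rs n zero by simp
    next
      case up
      then have "R n $$ (r, s) = [:c:] * p (Suc s) (Suc n)"
        using rs A_c by (auto simp: Rrs B_zero)
      \<comment> \<open>In 1-based terms the row is odd and the column even, so the condition
        applies at \<open>n\<close> itself. For finite support and \<open>n = N\<close> this
        involves the conventional polynomial of degree \<open>N + 1\<close>.\<close>
      moreover have "scalar_act (p (Suc s) (Suc n)) (\<delta> (Suc s))
          = smult (\<Lambda> (Suc r) n) (p (Suc s) (Suc n))"
        using assms(7)[of "Suc s" n] assms(8)[of "Suc r" "Suc s" n] up rs n by simp
      ultimately show ?thesis
        using scalar_act_const_mult[OF order(1,2)[OF rs(2)], of c "p (Suc s) (Suc n)"]
        by (simp add: mult.commute)
    next
      case down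
      show ?thesis
      proof (cases "n = 0")
        case True
        then have "R n $$ (r, s) = 0" unfolding Rrs using down rs by (auto simp: A_zero)
        then show ?thesis using zero by simp
      next
        case False
        then have "R n $$ (r, s) = [:-b:] * p (Suc s) (n - 1)"
          unfolding Rrs using down rs B_b by (auto simp: A_zero)
        \<comment> \<open>Now the column is the odd index and the row the even one, so the condition
          is taken at \<open>n - 1\<close>, with the roles of row and column exchanged.\<close>
        moreover have "scalar_act (p (Suc s) (n - 1)) (\<delta> (Suc s))
            = smult (\<Lambda> (Suc r) n) (p (Suc s) (n - 1))"
          using assms(6)[of "Suc s" "n - 1"] assms(8)[of "Suc s" "Suc r" "n - 1"]
            down rs False prev[OF n] by simp
        ultimately show ?thesis
          using scalar_act_const_mult[OF order(1,2)[OF rs(2)], of "-b" "p (Suc s) (n - 1)"]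
          by (simp add: mult.commute)
      qed
    qed
  qed

  have R_eig: "shift_act U V W (R n) = const_poly_mat (L n) * R n" if n: "n \<in> index_range J" for n
  proof (rule eq_matI)
    fix r s assume "r < dim_row (const_poly_mat (L n) * R n)" "s < dim_col (const_poly_mat (L n) * R n)"
    then have rs: "r < m" "s < m"
      using carr(1,6)[of n] by (auto simp: const_poly_mat_def)
    have "shift_act U V W (R n) $$ (r, s) = scalar_act (R n $$ (r, s)) (\<delta> (Suc s))"
      unfolding U_def V_def W_def
      using shift_act_diag_index[OF carr(1) rs, of "\<lambda>k. \<delta> (Suc k)"] order[OF rs(2)] by simp
    also have "\<dots> = (const_poly_mat (L n) * R n) $$ (r, s)"
      using rs carr(1)[of n] entry[OF n rs]
      by (simp add: L_def const_poly_mat_diag mat_diag_mult_left[of _ m m])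
    finally show "shift_act U V W (R n) $$ (r, s) = (const_poly_mat (L n) * R n) $$ (r, s)" .
  qed (use carrier_matD[OF carr(1)] carrier_matD[OF carr(6)] carr(7-9) in \<open>auto simp: shift_act_def const_poly_mat_def\<close>)

  \<comment> \<open>Transfer to \<open>Q_mat\<close>, and the order of \<open>D\<close>\<close>
  have "eigenfunction_matrix m (index_range J) (Q_mat m J w p a) D"
    unfolding eigenfunction_matrix_def
  proof (intro exI[of _ L] ballI conjI)
    fix n assume n: "n \<in> index_range J"
    have "matrix_act m (R n * S) D = shift_act (T1 * U * S) (T * V * S) (T2 * W * S) (R n * S)"
      unfolding D_def using carr by (intro matrix_act_shift_diff_op) auto
    also have "\<dots> = shift_act U V W (R n) * S"
      unfolding T1_def T2_def using carr ST by (intro shift_act_conjugate) auto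
    also have "\<dots> = const_poly_mat (L n) * (R n * S)"
      using R_eig[OF n] carr by (simp add: assoc_mult_mat[of _ m m _ m _ m])
    finally show "matrix_act m (Q_mat m J w p a n) D = const_poly_mat (L n) * Q_mat m J w p a n"
      by (simp add: Q)
  qed (use carr in auto)
  moreover have "second_order_matrix m D"
  proof -
    have m: "0 < m" using assms(1) by simp
    \<comment> \<open>Column 0 of \<open>X\<close> vanishes, its 1-based index being odd. Position
      \<open>(0, 0)\<close> is therefore a safe witness: there the outer shift coefficients of
      \<open>D\<close> equal those of \<open>\<delta> 1\<close>, which are nonzero.\<close>
    have S0: "S $$ (k, 0) = (if k = 0 then 1 else 0)" if "k < m" for k
      using that m carr_AB(2) by (simp add: S_def X_zero)
    have T0: "T1 $$ (0, 0) = 1" "T2 $$ (0, 0) = 1"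
      using m carr_AB(2) carrier_matD[OF carr(3)]
      by (simp_all add: T1_def T2_def) (simp_all add: T_def X_zero)
    have "(T1 * U * S) $$ (0, 0) \<noteq> 0"
      unfolding U_def using order[OF m] carr m S0 T0 by (subst diag_conjugate_index_0) auto
    moreover have "(T2 * W * S) $$ (0, 0) \<noteq> 0"
      unfolding W_def using order[OF m] carr m S0 T0 by (subst diag_conjugate_index_0) auto
    moreover have "T1 * U * S \<in> carrier_mat m m" "T2 * W * S \<in> carrier_mat m m"
        "T * V * S \<in> carrier_mat m m"
      using carr by auto
    ultimately show ?thesis
      unfolding D_def using m by (intro second_order_matrix_shift_diff_op[of _ m]) auto
  qed
  ultimately show ?thesis by blast
qed

end
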